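(* Let $P$ be a finite poset with minimum $\hat0$, let $\rho:P\to\mathbb N$ and $m\in\mathbb N$ with $\max_{x\in P}\rho(x)\le m$, and let $\chi(P,t)$ be the characteristic polynomial with respect to $\rho$ and $m$. Let $(A_1,\dots,A_n)$ be an ordered partition of the atom set $A(P)$ and let $f:\prod_{i=1}^nRT_{\hat U(A_i)}\to P$ be a complete transversal function. Define $$T=\{x\in P\setminus\{\hat0\}:\ |A_i\cap A_x|\neq1\text{ for all }i\}.$$ Suppose: (1) if $\mathbf t\in\mathcal T_x^a$ then $|\operatorname{supp}\mathbf t|=\rho(x)$; (2) if $x,y\in P$ and $x<y$, then $\rho(x)<\rho(y)$; (3) for all minimal elements $x,y$ of $T$, the cardinalities of $\{i:|A_i\cap A_x|\ne0\}$ and $\{i:|A_i\cap A_y|\neq0\}$ have the same parity. Then $\chi(P,t)=t^{m-n}\prod_{i=1}^n(t-|A_i|)$ if and only if for every nonzero $x\in P$ there is an index $i$ with $|A_i\cap A_x|=1$.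
   Context: All posets are finite with minimum $\hat0$; $\mu$ is the Möbius function ($\sum_{y\le x}\mu(y)=\delta_{\hat0,x}$) and $\chi(P,t)=\sum_{x\in P}\mu(x)t^{m-\rho(x)}$. $A_x$ is the set of atoms of $P$ below $x$. For $S\subseteq P$ containing $\hat0$, $RT_S$ is the poset of saturated chains of $P$ starting at $\hat0$ using only elements of $S$, ordered by containment; elements are identified with their top element. $\hat U(A)$ is the upper order ideal generated by the set of atoms $A$, together with $\hat0$. The product is ordered componentwise, elements $\mathbf t=(t_1,\dots,t_n)$. A complete transversal function is an order-preserving $f:\prod_iRT_{\hat U(A_i)}\to P$ such that if each $t_i$ is $\hat0$ or (has top element) $x$, then $f(\mathbf t)=x$. $\mathcal T_x=f^{-1}(x)$; $\mathbf t$ is atomic if each $t_i$ is $\hat0$ or an atom of $RT_{\hat U(A_i)}$; $\mathcal T_x^a$ is the set of atomic elements of $\mathcal T_x$; $\operatorname{supp}\mathbf t=\{i:t_i\ne\hat0\}$. *)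

theory Defs
  imports Main "HOL-Library.FuncSet" "HOL-Library.Disjoint_Sets"
    "HOL-Computational_Algebra.Polynomial"
begin

text \<open>
  A finite poset with minimum is a type of class \<open>{finite, order_bot}\<close>: the poset is the whole
  type and its minimum is \<open>bot\<close>.
\<close>

definition covers :: "'p::order \<Rightarrow> 'p \<Rightarrow> bool" where
  "covers x y \<longleftrightarrow> x < y \<and> \<not> (\<exists>z. x < z \<and> z < y)"

definition atoms :: "'p::order_bot set" where
  "atoms = {a. covers bot a}"

definition atoms_below :: "'p::order_bot \<Rightarrow> 'p set" where
  "atoms_below x = {a \<in> atoms. a \<le> x}"

function mobius :: "'p::{finite,order_bot} \<Rightarrow> int" where
  "mobius x = (if x = bot then 1 else - (\<Sum>y | y < x. mobius y))"
  by pat_completeness auto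
termination
  by (relation "measure (\<lambda>x. card {z. z < x})")
     (auto intro!: psubset_card_mono intro: less_trans)

declare mobius.simps [simp del]

lemma sum_mobius:
  fixes x :: "'p::{finite,order_bot}"
  shows "(\<Sum>y | y \<le> x. mobius y) = (if x = bot then 1 else 0)"
proof -
  have "{y. y \<le> x} = insert x {y. y < x}"
    by auto
  then have "(\<Sum>y | y \<le> x. mobius y) = mobius x + (\<Sum>y | y < x. mobius y)"
    by simp
  then show ?thesis
    by (auto simp: mobius.simps [of x])
qed

text \<open>The truncated subtraction is the true one whenever \<open>\<rho>\<close> is bounded by \<open>m\<close>.\<close>

definition characteristic_polynomial ::
    "('p::{finite,order_bot} \<Rightarrow> nat) \<Rightarrow> nat \<Rightarrow> int poly" where
  "characteristic_polynomial \<rho> m = (\<Sum>x\<in>UNIV. monom (mobius x) (m - \<rho> x))"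

text \<open>
  Blocks are indexed by \<open>{1..n}\<close> and, as usual for partitions, are nonempty.
\<close>

definition ordered_partition :: "nat \<Rightarrow> (nat \<Rightarrow> 'a set) \<Rightarrow> 'a set \<Rightarrow> bool" where
  "ordered_partition n A X \<longleftrightarrow>
     (\<Union>i\<in>{1..n}. A i) = X \<and> disjoint_family_on A {1..n} \<and> (\<forall>i\<in>{1..n}. A i \<noteq> {})"

definition upper_hat :: "'p::order_bot set \<Rightarrow> 'p set" where
  "upper_hat B = insert bot {x. \<exists>a\<in>B. a \<le> x}"

text \<open>
  Chains are represented by their sets of elements. A chain of a finite poset is saturated if
  consecutive elements of the chain are covering pairs of the whole poset.
\<close>

definition saturated_chain :: "'p::{finite,order} set \<Rightarrow> bool" where
  "saturated_chain C \<longleftrightarrow>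
     Complete_Partial_Order.chain (\<le>) C \<and>
     (\<forall>x\<in>C. \<forall>y\<in>C. x < y \<and> \<not> (\<exists>z\<in>C. x < z \<and> z < y) \<longrightarrow> covers x y)"

text \<open>
  The rooted tree \<open>RT\<^sub>S\<close>. Its order is set inclusion, and its minimum is the chain \<open>{bot}\<close>.
\<close>

definition rooted_tree :: "'p::{finite,order_bot} set \<Rightarrow> 'p set set" where
  "rooted_tree S = {C. saturated_chain C \<and> bot \<in> C \<and> C \<subseteq> S}"

definition rooted_tree_atoms :: "'p::{finite,order_bot} set \<Rightarrow> 'p set set" where
  "rooted_tree_atoms S =
     {C \<in> rooted_tree S. {bot} \<subset> C \<and> \<not> (\<exists>D\<in>rooted_tree S. {bot} \<subset> D \<and> D \<subset> C)}"

definition top_element :: "'p::order set \<Rightarrow> 'p" where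
  "top_element C = (GREATEST x. x \<in> C)"

definition tree_product :: "nat \<Rightarrow> (nat \<Rightarrow> 'p::{finite,order_bot} set) \<Rightarrow> (nat \<Rightarrow> 'p set) set" where
  "tree_product n A = (\<Pi>\<^sub>E i\<in>{1..n}. rooted_tree (upper_hat (A i)))"

text \<open>
  Members of \<^term>\<open>tree_product n A\<close> agree outside \<open>{1..n}\<close>, so the pointwise order on functions
  used by \<^const>\<open>mono_on\<close> is the componentwise order of the product. In the second conjunct some
  component is required to have top element \<open>x\<close>: otherwise the zero tuple would have to be sent
  to every \<open>x\<close>. With \<open>x = bot\<close> it says that the zero tuple is sent to \<open>bot\<close>.
\<close>

definition complete_transversal ::
    "nat \<Rightarrow> (nat \<Rightarrow> 'p::{finite,order_bot} set) \<Rightarrow> ((nat \<Rightarrow> 'p set) \<Rightarrow> 'p) \<Rightarrow> bool" where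
  "complete_transversal n A f \<longleftrightarrow>
     mono_on (tree_product n A) f \<and>
     (\<forall>t\<in>tree_product n A. \<forall>x.
        (\<forall>i\<in>{1..n}. t i = {bot} \<or> top_element (t i) = x) \<and>
        (\<exists>i\<in>{1..n}. top_element (t i) = x) \<longrightarrow> f t = x)"

definition transversals ::
    "nat \<Rightarrow> (nat \<Rightarrow> 'p::{finite,order_bot} set) \<Rightarrow> ((nat \<Rightarrow> 'p set) \<Rightarrow> 'p) \<Rightarrow> 'p
      \<Rightarrow> (nat \<Rightarrow> 'p set) set" where
  "transversals n A f x = {t \<in> tree_product n A. f t = x}"

definition atomic_transversals ::
    "nat \<Rightarrow> (nat \<Rightarrow> 'p::{finite,order_bot} set) \<Rightarrow> ((nat \<Rightarrow> 'p set) \<Rightarrow> 'p) \<Rightarrow> 'p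
      \<Rightarrow> (nat \<Rightarrow> 'p set) set" where
  "atomic_transversals n A f x =
     {t \<in> transversals n A f x.
        \<forall>i\<in>{1..n}. t i = {bot} \<or> t i \<in> rooted_tree_atoms (upper_hat (A i))}"

definition supp :: "nat \<Rightarrow> (nat \<Rightarrow> 'p::order_bot set) \<Rightarrow> nat set" where
  "supp n t = {i \<in> {1..n}. t i \<noteq> {bot}}"

definition minimal_elements :: "'p::order set \<Rightarrow> 'p set" where
  "minimal_elements T = {x \<in> T. \<not> (\<exists>y\<in>T. y < x)}"

end

theory Submission imports Defs begin

text \<open>
  Choosing in each block either \<open>\<bottom>\<close> or an atom yields an atomic tuple \<open>s\<close>, and its image
  \<open>\<phi> s\<close> under \<open>f\<close> satisfies \<open>\<phi> s \<le> x\<close> iff every chosen atom lies below \<open>x\<close>: one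
  direction is monotonicity, for the other prolong each atom to a saturated chain ending in \<open>x\<close>.
  Hence \<open>g x = (\<Sum>s | \<phi> s = x. (-1) ^ |supp s|)\<close> has the lower sums
  \<open>\<Sum>y\<le>x. g y = (\<Prod>i. 1 - |A\<^sub>i \<inter> A\<^sub>x|)\<close>, while hypothesis (1) turns the product side of the
  theorem into \<open>\<Sum>x. g x t^(m - \<rho> x)\<close>. The lower sums of \<open>\<mu> - g\<close> vanish off \<open>T\<close>, which gives one
  implication. If \<open>T\<close> is nonempty, let \<open>k\<close> be the least rank in it: at rank \<open>k\<close> the function
  \<open>\<mu> - g\<close> is supported on minimal elements of \<open>T\<close>, where by the parity hypothesis it has constant
  sign, so the two polynomials differ in degree \<open>m - k\<close>.
\<close>

section \<open>Products and sums\<close>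

lemma prod_monom:
  fixes a :: "'i \<Rightarrow> 'a::comm_semiring_1"
  shows "finite I \<Longrightarrow> (\<Prod>i\<in>I. monom (a i) (d i)) = monom (\<Prod>i\<in>I. a i) (\<Sum>i\<in>I. d i)"
  by (induction I rule: finite_induct) (auto simp: mult_monom one_pCons monom_0)

lemma prod_sign_conv_power:
  "finite I \<Longrightarrow> (\<Prod>i\<in>I. if P i then (-1::'a::comm_ring_1) else 1) = (-1) ^ card {i\<in>I. P i}"
  by (simp add: prod.inter_filter [symmetric])

text \<open>By strong induction on the number of elements below, \<open>h\<close> vanishes strictly
  below \<open>x\<close>, so only the term at \<open>x\<close> survives. This evaluates the
  difference of \<open>mobius\<close> and \<open>signed_count\<close> at elements with no member of
  \<open>T\<close> strictly below them.\<close>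

lemma eq_lower_sum:
  fixes h :: "'p::{finite,order} \<Rightarrow> 'a::comm_monoid_add"
  assumes "\<And>y. y < x \<Longrightarrow> (\<Sum>z | z \<le> y. h z) = 0"
  shows "h x = (\<Sum>z | z \<le> x. h z)"
proof -
  have split: "(\<Sum>z | z \<le> y. h z) = h y + (\<Sum>z | z < y. h z)" for y
  proof -
    have "{z. z \<le> y} = insert y {z. z < y}" by auto
    then show ?thesis by simp
  qed
  have "y < x \<longrightarrow> h y = 0" for y
  proof (induction "card {z. z < y}" arbitrary: y rule: less_induct)
    case less
    show ?case
    proof
      assume "y < x"
      have "h z = 0" if "z < y" for z
      proof -
        have "card {w. w < z} < card {w. w < y}"
          using that by (intro psubset_card_mono) auto
        with less \<open>y < x\<close> that show ?thesis by auto
      qed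
      then have "(\<Sum>z | z < y. h z) = 0" by simp
      with split [of y] assms [OF \<open>y < x\<close>] show "h y = 0" by simp
    qed
  qed
  with split [of x] show ?thesis by simp
qed

section \<open>Saturated chains\<close>

lemma top_element_eqI:
  assumes "x \<in> C" "\<And>y. y \<in> C \<Longrightarrow> y \<le> x"
  shows "top_element C = x"
  unfolding top_element_def using assms by (rule Greatest_equality)

lemma saturated_chain_insert:
  assumes "saturated_chain C" "z \<in> C" "\<And>y. y \<in> C \<Longrightarrow> y \<le> z" "covers z x"
  shows "saturated_chain (insert x C)"
proof -
  have zx: "z < x" using assms(4) by (simp add: covers_def)
  have lt: "y < x" if "y \<in> C" for y using assms(3) [OF that] zx by simp
  show ?thesis
    unfolding saturated_chain_def
  proof (intro conjI ballI impI)
    show "Complete_Partial_Order.chain (\<le>) (insert x C)"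
      using assms(1) lt unfolding saturated_chain_def chain_def by (auto intro: less_imp_le)
  next
    fix u v
    assume uv: "u \<in> insert x C" "v \<in> insert x C"
      "u < v \<and> \<not> (\<exists>w\<in>insert x C. u < w \<and> w < v)"
    have u: "u \<in> C" using uv lt by (auto dest: less_asym)
    show "covers u v"
    proof (cases "v = x")
      case True
      \<comment> \<open>No chain element lies strictly between \<open>u\<close> and the new top
        \<open>x\<close>, yet \<open>z\<close> would do so unless \<open>u = z\<close>.\<close>
      have "u = z" using uv True assms(2) assms(3) [OF u] zx by (auto simp: less_le)
      with True assms(4) show ?thesis by simp
    next
      case False
      with uv u assms(1) show ?thesis unfolding saturated_chain_def by auto
    qed
  qed
qed

lemma saturated_chain_pair:
  "covers x y \<Longrightarrow> saturated_chain {x, y}"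
  by (auto simp: saturated_chain_def chain_def covers_def)

lemma saturated_chain_singleton: "saturated_chain {x}"
  by (auto simp: saturated_chain_def chain_def)

text \<open>Descend from \<open>x\<close>: a maximal element of the half-open interval from
  \<open>a\<close> to \<open>x\<close> is covered by \<open>x\<close>, and a chain ending there can
  be prolonged. The bound \<open>insert bot {a..x}\<close> makes \<open>x\<close> the top element
  and keeps the chain inside \<open>upper_hat\<close> of any set containing
  \<open>a\<close>.\<close>

lemma exists_saturated_chain:
  assumes "a \<in> atoms" "a \<le> x"
  shows "\<exists>C. saturated_chain C \<and> bot \<in> C \<and> a \<in> C \<and> x \<in> C \<and> C \<subseteq> insert bot {a..x}"
  using assms(2)
proof (induction "card {z. z < x}" arbitrary: x rule: less_induct)
  case less
  show ?case
  proof (cases "x = a")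
    case True
    have "saturated_chain {bot, a}"
      using assms(1) by (intro saturated_chain_pair) (simp add: atoms_def)
    with True show ?thesis by auto
  next
    case False
    define M where "M = {z. a \<le> z \<and> z < x}"
    have "finite M" "M \<noteq> {}" using less.prems False by (auto simp: M_def)
    then obtain z where z: "z \<in> M" "\<And>y. y \<in> M \<Longrightarrow> z \<le> y \<Longrightarrow> y = z"
      by (metis finite_has_maximal)
    have az: "a \<le> z" "z < x" using z(1) by (auto simp: M_def)
    have "covers z x"
      unfolding covers_def
    proof (intro conjI notI)
      assume "\<exists>w. z < w \<and> w < x"
      then obtain w where w: "z < w" "w < x" by blast
      then have "w \<in> M" using az by (auto simp: M_def)
      with z(2) [of w] w show False by (simp add: less_le)
    qed (rule az)
    have "card {w. w < z} < card {w. w < x}"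
      using az by (intro psubset_card_mono) auto
    from less.hyps [OF this az(1)] obtain C where
      C: "saturated_chain C" "bot \<in> C" "a \<in> C" "z \<in> C" "C \<subseteq> insert bot {a..z}"
      by blast
    have "saturated_chain (insert x C)"
      using C \<open>covers z x\<close> by (intro saturated_chain_insert [of _ z]) auto
    moreover have "insert x C \<subseteq> insert bot {a..x}"
      using C(5) az by fastforce
    ultimately show ?thesis using C by blast
  qed
qed

lemma exists_atom_below:
  fixes x :: "'p::{finite,order_bot}"
  assumes "x \<noteq> bot"
  shows "\<exists>a\<in>atoms. a \<le> x"
proof -
  define M where "M = {z. z \<noteq> bot \<and> z \<le> x}"
  have "finite M" "M \<noteq> {}" using assms by (auto simp: M_def)
  then obtain a where a: "a \<in> M" "\<And>y. y \<in> M \<Longrightarrow> y \<le> a \<Longrightarrow> y = a"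
    by (metis finite_has_minimal)
  then have ax: "a \<noteq> bot" "a \<le> x" by (auto simp: M_def)
  have "covers bot a"
    unfolding covers_def
  proof (intro conjI notI)
    show "bot < a" using ax by (simp add: bot.not_eq_extremum)
    assume "\<exists>z. bot < z \<and> z < a"
    then obtain z where z: "bot < z" "z < a" by blast
    then have "z \<in> M" using ax by (auto simp: M_def)
    with a(2) [of z] z show False by (simp add: less_le)
  qed
  with ax show ?thesis by (auto simp: atoms_def)
qed

lemma bot_notin_atoms: "bot \<notin> atoms"
  by (simp add: atoms_def covers_def)

section \<open>Tuples of atoms\<close>

text \<open>An atomic tuple is recorded by the top elements of its components, with
  \<open>bot\<close> marking the indices outside the support.\<close>

definition atom_choices :: "nat \<Rightarrow> (nat \<Rightarrow> 'p::order_bot set) \<Rightarrow> (nat \<Rightarrow> 'p) set" where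
  "atom_choices n A = (\<Pi>\<^sub>E i\<in>{1..n}. insert bot (A i))"

text \<open>Since \<open>{bot, bot}\<close> is \<open>{bot}\<close>, one formula yields both the
  trivial chain and the atoms of the tree.\<close>

definition choice_tuple :: "nat \<Rightarrow> (nat \<Rightarrow> 'p::order_bot) \<Rightarrow> nat \<Rightarrow> 'p set" where
  "choice_tuple n s = (\<lambda>i\<in>{1..n}. {bot, s i})"

lemma supp_choice_tuple: "supp n (choice_tuple n s) = {i\<in>{1..n}. s i \<noteq> bot}"
  by (auto simp: supp_def choice_tuple_def)

lemma atom_pair_in_rooted_tree_atoms:
  assumes "A \<subseteq> atoms" "a \<in> A"
  shows "{bot, a} \<in> rooted_tree_atoms (upper_hat A)"
proof -
  have "covers bot a" using assms by (auto simp: atoms_def)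
  then have "saturated_chain {bot, a}" by (rule saturated_chain_pair)
  moreover have "a \<noteq> bot" using assms bot_notin_atoms by auto
  ultimately show ?thesis
    using assms by (auto simp: rooted_tree_atoms_def rooted_tree_def upper_hat_def)
qed

lemma bot_in_rooted_tree: "{bot} \<in> rooted_tree (upper_hat A)"
  by (simp add: rooted_tree_def upper_hat_def saturated_chain_singleton)

text \<open>This makes the hypothesis relating support size to rank applicable to every
  choice.\<close>

lemma choice_tuple_atomic:
  assumes "\<And>i. i \<in> {1..n} \<Longrightarrow> A i \<subseteq> atoms" "s \<in> atom_choices n A"
  shows "choice_tuple n s \<in> atomic_transversals n A f (f (choice_tuple n s))"
proof -
  have *: "{bot, s i} = {bot} \<or> {bot, s i} \<in> rooted_tree_atoms (upper_hat (A i))"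
    if "i \<in> {1..n}" for i
  proof -
    have "s i \<in> insert bot (A i)"
      using PiE_mem [OF assms(2) [unfolded atom_choices_def] that] .
    then show ?thesis
      using atom_pair_in_rooted_tree_atoms [OF assms(1) [OF that]] by auto
  qed
  moreover have "{bot, s i} \<in> rooted_tree (upper_hat (A i))" if "i \<in> {1..n}" for i
    using * [OF that] bot_in_rooted_tree [of "A i"] by (auto simp: rooted_tree_atoms_def)
  ultimately show ?thesis
    by (auto simp: atomic_transversals_def transversals_def tree_product_def choice_tuple_def)
qed

lemma choice_tuple_in_tree_product:
  assumes "\<And>i. i \<in> {1..n} \<Longrightarrow> A i \<subseteq> atoms" "s \<in> atom_choices n A"
  shows "choice_tuple n s \<in> tree_product n A"
  \<comment> \<open>Membership in the product does not involve the function, so a constant one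
    serves as a dummy.\<close>
  using choice_tuple_atomic [OF assms, where f = "\<lambda>_. bot"]
  by (simp add: atomic_transversals_def transversals_def)

lemma complete_transversalD:
  assumes "complete_transversal n A f" "t \<in> tree_product n A"
    "\<And>i. i \<in> {1..n} \<Longrightarrow> t i = {bot} \<or> top_element (t i) = x"
    "i \<in> {1..n}" "top_element (t i) = x"
  shows "f t = x"
  using assms unfolding complete_transversal_def by blast

lemma complete_transversal_choice_le_iff:
  fixes f :: "(nat \<Rightarrow> 'p::{finite,order_bot} set) \<Rightarrow> 'p"
  assumes part: "ordered_partition n A atoms" and f: "complete_transversal n A f"
    and s: "s \<in> atom_choices n A"
  shows "f (choice_tuple n s) \<le> x \<longleftrightarrow> (\<forall>i\<in>{1..n}. s i \<le> x)"
proof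
  have A: "A i \<subseteq> atoms" if "i \<in> {1..n}" for i
    using part that by (auto simp: ordered_partition_def)
  have s_mem: "s i \<in> insert bot (A i)" if "i \<in> {1..n}" for i
    using PiE_mem [OF s [unfolded atom_choices_def] that] .
  have mono: "f t \<le> f u" if "t \<in> tree_product n A" "u \<in> tree_product n A" "t \<le> u" for t u
    using f that by (auto simp: complete_transversal_def dest: mono_onD)
  have top: "top_element {bot, a} = a" for a :: 'p
    by (rule top_element_eqI) auto
  show "\<forall>i\<in>{1..n}. s i \<le> x" if le: "f (choice_tuple n s) \<le> x"
  proof
    fix i assume i: "i \<in> {1..n}"
    \<comment> \<open>Only coordinate \<open>i\<close> is kept, so completeness forces the image to
      be the atom (or \<open>bot\<close>) \<open>s i\<close> itself, and this tuple lies below the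
      original one.\<close>
    define s' where "s' = (\<lambda>j\<in>{1..n}. if j = i then s i else bot)"
    have s': "s' \<in> atom_choices n A"
      using s_mem [OF i] by (auto simp: s'_def atom_choices_def)
    have "f (choice_tuple n s') = s i"
    proof (rule complete_transversalD [OF f choice_tuple_in_tree_product [OF A s'], of _ i])
      show "top_element (choice_tuple n s' i) = s i"
        using i by (simp add: choice_tuple_def s'_def top)
    qed (use i in \<open>auto simp: choice_tuple_def s'_def top\<close>)
    moreover have "choice_tuple n s' \<le> choice_tuple n s"
      by (auto simp: le_fun_def choice_tuple_def s'_def)
    ultimately have "s i \<le> f (choice_tuple n s)"
      using mono [OF choice_tuple_in_tree_product [OF A s'] choice_tuple_in_tree_product [OF A s]]
      by simp
    with le show "s i \<le> x" by simp
  qed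
  show "f (choice_tuple n s) \<le> x" if le: "\<forall>i\<in>{1..n}. s i \<le> x"
  \<comment> \<open>Without blocks, completeness says nothing about the value of \<open>f\<close>,
    since it asks for an index. But then there are no atoms and the poset is a single point.\<close>
  proof (cases "n = 0")
    case True
    then have "atoms = ({} :: 'p set)" using part by (auto simp: ordered_partition_def)
    then have "y = bot" for y :: 'p using exists_atom_below [of y] by auto
    then show ?thesis by (metis order_refl)
  next
    case False
    \<comment> \<open>\<open>D i C\<close> says that \<open>C\<close> may replace component
      \<open>i\<close>: it contains \<open>{bot, s i}\<close>, so the new tuple dominates the old
      one, and it is trivial or ends in \<open>x\<close>, as completeness requires.\<close>
    define D where "D i C \<longleftrightarrow> C \<in> rooted_tree (upper_hat (A i)) \<and> {bot, s i} \<subseteq> C \<and>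
      (if s i = bot then C = {bot} else top_element C = x)" for i C
    have "\<exists>C. D i C" if i: "i \<in> {1..n}" for i
    proof (cases "s i = bot")
      case True
      then show ?thesis by (auto simp: D_def bot_in_rooted_tree)
    next
      case False
      then have si: "s i \<in> A i" using s_mem [OF i] by simp
      obtain C where C: "saturated_chain C" "bot \<in> C" "s i \<in> C" "x \<in> C"
        "C \<subseteq> insert bot {s i..x}"
        using exists_saturated_chain [of "s i" x] A [OF i] si le i by blast
      moreover have "top_element C = x"
        using C by (intro top_element_eqI) auto
      moreover have "C \<subseteq> upper_hat (A i)"
        using C(5) si by (fastforce simp: upper_hat_def)
      ultimately show ?thesis using False by (auto simp: D_def rooted_tree_def)
    qed
    then obtain c where c: "\<And>i. i \<in> {1..n} \<Longrightarrow> D i (c i)" by metis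
    define t where "t = restrict c {1..n}"
    have t: "t \<in> tree_product n A"
      using c by (auto simp: t_def D_def tree_product_def)
    have "choice_tuple n s \<le> t"
      using c by (auto simp: le_fun_def choice_tuple_def t_def D_def)
    then have "f (choice_tuple n s) \<le> f t"
      using mono choice_tuple_in_tree_product [OF A s] t by blast
    also have "f t \<le> x"
    proof (cases "\<exists>i\<in>{1..n}. s i \<noteq> bot")
      case True
      then obtain i where i: "i \<in> {1..n}" "s i \<noteq> bot" by blast
      have "f t = x"
      proof (rule complete_transversalD [OF f t _ i(1)])
        show "top_element (t i) = x" using c [OF i(1)] i by (simp add: t_def D_def)
        show "t j = {bot} \<or> top_element (t j) = x" if "j \<in> {1..n}" for j
          using c [OF that] that by (auto simp: t_def D_def split: if_splits)
      qed
      then show ?thesis by simp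
    next
      case nil: False
      have tj: "t j = {bot}" if "j \<in> {1..n}" for j
        using c [OF that] nil that by (auto simp: t_def D_def)
      \<comment> \<open>All components are trivial; completeness is applied with value
        \<open>bot\<close>, and any index can witness it.\<close>
      have "1 \<in> {1..n}" using False by simp
      then have "f t = bot"
        by (intro complete_transversalD [OF f t, of _ 1]) (use tj top [of bot] in auto)
      then show ?thesis by simp
    qed
    finally show ?thesis .
  qed
qed

section \<open>Signed counts of atomic tuples\<close>

definition choice_sign :: "nat \<Rightarrow> (nat \<Rightarrow> 'p::order_bot) \<Rightarrow> int" where
  "choice_sign n s = (\<Prod>i\<in>{1..n}. if s i = bot then 1 else -1)"

definition signed_count :: "nat \<Rightarrow> (nat \<Rightarrow> 'p::{finite,order_bot} set) \<Rightarrow>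
    ((nat \<Rightarrow> 'p set) \<Rightarrow> 'p) \<Rightarrow> 'p \<Rightarrow> int" where
  "signed_count n A f x =
     (\<Sum>s | s \<in> atom_choices n A \<and> f (choice_tuple n s) = x. choice_sign n s)"

lemma finite_atom_choices:
  fixes A :: "nat \<Rightarrow> 'p::{finite,order_bot} set"
  shows "finite (atom_choices n A)"
  unfolding atom_choices_def by (intro finite_PiE) auto

text \<open>Adding up the fibres over all \<open>y \<le> x\<close> collects the choices whose image
  lies below \<open>x\<close>. This condition is coordinatewise, so they form a product of sets and
  the multiplicative sign factors: each block gives 1 for \<open>bot\<close> and -1 for each atom
  below \<open>x\<close>.\<close>

lemma lower_sum_signed_count:
  fixes f :: "(nat \<Rightarrow> 'p::{finite,order_bot} set) \<Rightarrow> 'p"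
  assumes part: "ordered_partition n A atoms" and f: "complete_transversal n A f"
  shows "(\<Sum>y | y \<le> x. signed_count n A f y) =
    (\<Prod>i\<in>{1..n}. 1 - int (card (A i \<inter> atoms_below x)))"
proof -
  have A: "A i \<subseteq> atoms" if "i \<in> {1..n}" for i
    using part that by (auto simp: ordered_partition_def)
  let ?S = "{s \<in> atom_choices n A. f (choice_tuple n s) \<le> x}"
  have "(\<Sum>y | y \<le> x. signed_count n A f y) =
      (\<Sum>y | y \<le> x. \<Sum>s | s \<in> ?S \<and> f (choice_tuple n s) = y. choice_sign n s)"
    unfolding signed_count_def by (intro sum.cong) auto
  also have "\<dots> = (\<Sum>s\<in>?S. choice_sign n s)"
    using finite_atom_choices [of n A] by (intro sum.group) auto
  also have "?S = (\<Pi>\<^sub>E i\<in>{1..n}. insert bot (A i \<inter> atoms_below x))"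
  proof -
    have "?S = {s \<in> atom_choices n A. \<forall>i\<in>{1..n}. s i \<le> x}"
      using complete_transversal_choice_le_iff [OF part f] by blast
    also have "\<dots> = (\<Pi>\<^sub>E i\<in>{1..n}. {a \<in> insert bot (A i). a \<le> x})"
      unfolding atom_choices_def PiE_def Pi_def by blast
    also have "\<dots> = (\<Pi>\<^sub>E i\<in>{1..n}. insert bot (A i \<inter> atoms_below x))"
      using A by (intro PiE_cong) (auto simp: atoms_below_def)
    finally show ?thesis .
  qed
  also have "(\<Sum>s\<in>\<dots>. choice_sign n s) =
      (\<Prod>i\<in>{1..n}. \<Sum>a\<in>insert bot (A i \<inter> atoms_below x). if a = bot then 1 else -1)"
    unfolding choice_sign_def by (subst prod_sum_PiE) auto
  also have "\<dots> = (\<Prod>i\<in>{1..n}. 1 - int (card (A i \<inter> atoms_below x)))"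
  proof (intro prod.cong refl)
    fix i
    have nb: "bot \<notin> A i \<inter> atoms_below x"
      using bot_notin_atoms by (auto simp: atoms_below_def)
    then have "(\<Sum>a\<in>A i \<inter> atoms_below x. if a = bot then 1 else -1 :: int) =
        (\<Sum>a\<in>A i \<inter> atoms_below x. -1)"
      by (intro sum.cong) auto
    with nb show "(\<Sum>a\<in>insert bot (A i \<inter> atoms_below x). if a = bot then 1 else -1) =
        1 - int (card (A i \<inter> atoms_below x))"
      by simp
  qed
  finally show ?thesis .
qed

text \<open>The support hypothesis makes each exponent depend on the choice alone. Expanding the
  product runs over the same choices: the variable in a factor corresponds to \<open>bot\<close>,
  the constant term to the atoms of the block.\<close>

lemma sum_monom_signed_count:
  fixes f :: "(nat \<Rightarrow> 'p::{finite,order_bot} set) \<Rightarrow> 'p"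
  assumes part: "ordered_partition n A atoms"
    and \<rho>: "\<And>x. \<rho> x \<le> m"
    and supp: "\<And>x t. t \<in> atomic_transversals n A f x \<Longrightarrow> card (supp n t) = \<rho> x"
  shows "(\<Sum>x\<in>UNIV. monom (signed_count n A f x) (m - \<rho> x)) =
    monom 1 (m - n) * (\<Prod>i=1..n. [:- int (card (A i)), 1:])"
proof -
  have A: "A i \<subseteq> atoms" if "i \<in> {1..n}" for i
    using part that by (auto simp: ordered_partition_def)
  have rank: "\<rho> (f (choice_tuple n s)) = card {i\<in>{1..n}. s i \<noteq> bot}"
    if "s \<in> atom_choices n A" for s
    using supp [OF choice_tuple_atomic [OF A that]] by (simp add: supp_choice_tuple)
  \<comment> \<open>Blocks are nonempty, so some choice has full support; its image has rank
    \<open>n\<close>, which is at most \<open>m\<close>. Hence \<open>m - n\<close> is not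
    truncated.\<close>
  have "n \<le> m"
  proof -
    have "\<exists>a. a \<in> A i" if "i \<in> {1..n}" for i
      using part that by (auto simp: ordered_partition_def)
    then obtain s where s: "\<And>i. i \<in> {1..n} \<Longrightarrow> s i \<in> A i" by metis
    define s' where "s' = restrict s {1..n}"
    have "s' \<in> atom_choices n A" using s by (auto simp: s'_def atom_choices_def)
    from rank [OF this] have "\<rho> (f (choice_tuple n s')) = card {i\<in>{1..n}. s' i \<noteq> bot}" .
    also have "{i\<in>{1..n}. s' i \<noteq> bot} = {1..n}"
      using s A bot_notin_atoms by (fastforce simp: s'_def)
    finally show ?thesis using \<rho> [of "f (choice_tuple n s')"] by simp
  qed
  \<comment> \<open>The exponent is \<open>m - n\<close> plus the number of coordinates equal to
    \<open>bot\<close>, each of which contributes one power of the variable.\<close>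
  have monom_choice: "monom (choice_sign n s) (m - card {i\<in>{1..n}. s i \<noteq> bot}) =
      monom 1 (m - n) * (\<Prod>i\<in>{1..n}. if s i = bot then monom 1 1 else monom (-1) 0)"
    for s :: "nat \<Rightarrow> 'p"
  proof -
    have "card {1..n} = card ({i\<in>{1..n}. s i = bot} \<union> {i\<in>{1..n}. s i \<noteq> bot})"
      by (rule arg_cong [where f = card]) auto
    also have "\<dots> = card {i\<in>{1..n}. s i = bot} + card {i\<in>{1..n}. s i \<noteq> bot}"
      by (rule card_Un_disjoint) auto
    finally have "card {i\<in>{1..n}. s i = bot} + card {i\<in>{1..n}. s i \<noteq> bot} = n"
      by simp
    then have deg: "m - card {i\<in>{1..n}. s i \<noteq> bot} = m - n + card {i\<in>{1..n}. s i = bot}"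
      using \<open>n \<le> m\<close> by simp
    have "(\<Prod>i\<in>{1..n}. if s i = bot then monom 1 1 else monom (-1) 0) =
        (\<Prod>i\<in>{1..n}. monom (if s i = bot then 1 else -1) (if s i = bot then 1 else 0))"
      by (intro prod.cong) auto
    also have "\<dots> = monom (choice_sign n s) (card {i\<in>{1..n}. s i = bot})"
      by (simp add: prod_monom choice_sign_def sum.inter_filter [symmetric])
    finally show ?thesis by (simp only: mult_monom deg mult_1)
  qed
  have "(\<Sum>x\<in>UNIV. monom (signed_count n A f x) (m - \<rho> x)) =
      (\<Sum>x\<in>UNIV. \<Sum>s | s \<in> atom_choices n A \<and> f (choice_tuple n s) = x.
        monom (choice_sign n s) (m - \<rho> (f (choice_tuple n s))))"
    unfolding signed_count_def by (intro sum.cong refl) (simp add: monom_sum)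
  also have "\<dots> = (\<Sum>s\<in>atom_choices n A. monom (choice_sign n s) (m - \<rho> (f (choice_tuple n s))))"
    using finite_atom_choices [of n A] by (intro sum.group) auto
  also have "\<dots> = (\<Sum>s\<in>atom_choices n A. monom 1 (m - n) *
      (\<Prod>i\<in>{1..n}. if s i = bot then monom 1 1 else monom (-1) 0))"
    by (intro sum.cong refl) (simp only: rank monom_choice)
  also have "\<dots> = monom 1 (m - n) *
      (\<Prod>i\<in>{1..n}. \<Sum>a\<in>insert bot (A i). if a = bot then monom 1 1 else monom (-1) 0)"
    unfolding atom_choices_def by (subst prod_sum_PiE) (auto simp: sum_distrib_left)
  also have "(\<Prod>i\<in>{1..n}. \<Sum>a\<in>insert bot (A i). if a = bot then monom 1 1 else monom (-1) 0) =
      (\<Prod>i=1..n. [:- int (card (A i)), 1:])"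
  proof (intro prod.cong refl)
    fix i assume "i \<in> {1..n}"
    then have nb: "bot \<notin> A i" using A bot_notin_atoms by blast
    then have "(\<Sum>a\<in>A i. if a = bot then monom 1 1 else monom (-1) 0) =
        (\<Sum>a\<in>A i. [:-1 :: int:])"
      by (intro sum.cong) (auto simp: monom_0)
    with nb show "(\<Sum>a\<in>insert bot (A i). if a = bot then monom 1 1 else monom (-1) 0) =
        [:- int (card (A i)), 1:]"
      by (simp add: monom_Suc monom_0 of_nat_poly)
  qed
  finally show ?thesis .
qed

text \<open>A factor is 1 when \<open>c i\<close> is 0 and negative when \<open>c i\<close> is at
  least 2, so the nonzero counts alone decide the sign.\<close>

lemma sgn_prod_one_minus:
  fixes c :: "'i \<Rightarrow> nat"
  assumes "finite I" "\<And>i. i \<in> I \<Longrightarrow> c i \<noteq> 1"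
  shows "sgn (\<Prod>i\<in>I. 1 - int (c i)) = (-1) ^ card {i\<in>I. c i \<noteq> 0}"
proof -
  have "sgn (\<Prod>i\<in>I. 1 - int (c i)) = (\<Prod>i\<in>I. sgn (1 - int (c i)))"
    using assms(1) by (induction I rule: finite_induct) (auto simp: sgn_mult)
  also have "\<dots> = (\<Prod>i\<in>I. if c i \<noteq> 0 then -1 else 1)"
    using assms(2) by (intro prod.cong) (force simp: sgn_if)+
  also have "\<dots> = (-1) ^ card {i\<in>I. c i \<noteq> 0}"
    using assms(1) by (rule prod_sign_conv_power)
  finally show ?thesis .
qed

section \<open>Comparison of the two polynomials\<close>

theorem theorem17:
  fixes \<rho> :: "'p::{finite,order_bot} \<Rightarrow> nat"
    and m n :: nat
    and A :: "nat \<Rightarrow> 'p set"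
    and f :: "(nat \<Rightarrow> 'p set) \<Rightarrow> 'p"
    and T :: "'p set"
  assumes "\<And>x. \<rho> x \<le> m"
    and "ordered_partition n A atoms"
    and "complete_transversal n A f"
    and "T = {x. x \<noteq> bot \<and> (\<forall>i\<in>{1..n}. card (A i \<inter> atoms_below x) \<noteq> 1)}"
    and "\<And>x t. t \<in> atomic_transversals n A f x \<Longrightarrow> card (supp n t) = \<rho> x"
    and "\<And>x y. x < y \<Longrightarrow> \<rho> x < \<rho> y"
    and "\<And>x y. x \<in> minimal_elements T \<Longrightarrow> y \<in> minimal_elements T \<Longrightarrow>
           even (card {i \<in> {1..n}. card (A i \<inter> atoms_below x) \<noteq> 0}) \<longleftrightarrow>
           even (card {i \<in> {1..n}. card (A i \<inter> atoms_below y) \<noteq> 0})"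
  shows "characteristic_polynomial \<rho> m =
           monom 1 (m - n) * (\<Prod>i=1..n. [:- int (card (A i)), 1:]) \<longleftrightarrow>
         (\<forall>x. x \<noteq> bot \<longrightarrow> (\<exists>i\<in>{1..n}. card (A i \<inter> atoms_below x) = 1))"
proof -
  define F where "F x = (\<Prod>i\<in>{1..n}. 1 - int (card (A i \<inter> atoms_below x)))" for x
  define h where "h x = mobius x - signed_count n A f x" for x
  \<comment> \<open>At \<open>bot\<close> both lower sums are 1. At any other element outside
    \<open>T\<close>, some block has exactly one atom below it, which gives \<open>F\<close> a zero
    factor.\<close>
  have lower: "(\<Sum>y | y \<le> x. h y) = (if x \<in> T then - F x else 0)" for x
  proof -
    have "(\<Sum>y | y \<le> x. h y) = (if x = bot then 1 else 0) - F x"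
      by (simp add: h_def F_def sum_subtractf sum_mobius
          lower_sum_signed_count [OF assms(2,3)])
    moreover have "F bot = 1"
    proof -
      have "atoms_below bot = ({} :: 'p set)"
        using bot_notin_atoms by (auto simp: atoms_below_def bot_unique)
      then show ?thesis by (simp add: F_def)
    qed
    moreover have "F x = 0" if "x \<noteq> bot" "x \<notin> T"
    proof -
      from that obtain i where "i \<in> {1..n}" "card (A i \<inter> atoms_below x) = 1"
        by (auto simp: assms(4))
      then show ?thesis by (auto simp: F_def intro!: prod_zero)
    qed
    moreover have "bot \<notin> T" by (simp add: assms(4))
    ultimately show ?thesis by auto
  qed
  have diff: "characteristic_polynomial \<rho> m -
      monom 1 (m - n) * (\<Prod>i=1..n. [:- int (card (A i)), 1:]) = (\<Sum>x\<in>UNIV. monom (h x) (m - \<rho> x))"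
    by (simp only: sum_monom_signed_count [OF assms(2,1,5), symmetric]
        characteristic_polynomial_def h_def sum_subtractf diff_monom [symmetric])
  have "(\<Sum>x\<in>UNIV. monom (h x) (m - \<rho> x)) = 0 \<longleftrightarrow> T = {}"
  proof
    assume "T = {}"
    then have "h x = 0" for x
      using eq_lower_sum [of x h] lower by simp
    then show "(\<Sum>x\<in>UNIV. monom (h x) (m - \<rho> x)) = 0" by simp
  next
    assume zero: "(\<Sum>x\<in>UNIV. monom (h x) (m - \<rho> x)) = 0"
    show "T = {}"
    proof (rule ccontr)
      assume "T \<noteq> {}"
      then obtain x0 where x0: "x0 \<in> T" "\<And>y. y \<in> T \<Longrightarrow> \<rho> x0 \<le> \<rho> y"
        using ex_has_least_nat [of "\<lambda>x. x \<in> T" _ \<rho>] by blast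
      define R where "R = {x. \<rho> x = \<rho> x0}"
      \<comment> \<open>Anything strictly below \<open>x\<close> has rank less than the least rank
        in \<open>T\<close>, hence lies outside \<open>T\<close>, and all lower sums there
        vanish.\<close>
      have hR: "h x = (if x \<in> T then - F x else 0)" if "x \<in> R" for x
      proof -
        have "y \<notin> T" if "y < x" for y
          using assms(6) [OF that] x0(2) [of y] \<open>x \<in> R\<close> by (auto simp: R_def)
        then show ?thesis
          using eq_lower_sum [of x h] lower by simp
      qed
      have sgnF: "sgn (F x) = sgn (F x0) \<and> F x \<noteq> 0" if "x \<in> R" "x \<in> T" for x
      proof -
        have min: "y \<in> minimal_elements T" if "y \<in> R" "y \<in> T" for y
          using assms(6) x0(2) that by (fastforce simp: minimal_elements_def R_def)
        have sgn: "sgn (F y) = (-1) ^ card {i\<in>{1..n}. card (A i \<inter> atoms_below y) \<noteq> 0}"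
          if "y \<in> T" for y
          unfolding F_def using that by (intro sgn_prod_one_minus) (auto simp: assms(4))
        have "sgn (F x) = sgn (F x0)"
          using assms(7) [OF min [OF that] min [OF _ x0(1)]] x0(1) that
          by (simp add: sgn minus_one_power_iff R_def)
        moreover have "sgn (F x) \<noteq> 0" using sgn [OF that(2)] by simp
        ultimately show ?thesis by auto
      qed
      have "0 = coeff (\<Sum>x\<in>UNIV. monom (h x) (m - \<rho> x)) (m - \<rho> x0)"
        by (simp add: zero)
      \<comment> \<open>As ranks are at most \<open>m\<close>, the differences
        \<open>m - \<rho> x\<close> and \<open>m - \<rho> x0\<close> agree only for equal
        ranks.\<close>
      also have "\<dots> = (\<Sum>x\<in>UNIV. if x \<in> R then h x else 0)"
        unfolding coeff_sum
      proof (intro sum.cong refl)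
        fix x
        show "coeff (monom (h x) (m - \<rho> x)) (m - \<rho> x0) = (if x \<in> R then h x else 0)"
          using assms(1) [of x] assms(1) [of x0] by (auto simp: R_def)
      qed
      also have "\<dots> = (\<Sum>x\<in>R. h x)" by (simp add: sum.If_cases)
      finally have "(\<Sum>x\<in>R. h x * - sgn (F x0)) = 0"
        by (simp only: sum_distrib_right [symmetric])
      \<comment> \<open>On \<open>R\<close>, the common sign turns each term into the absolute value
        of \<open>F x\<close> for \<open>x\<close> in \<open>T\<close> and 0 otherwise, so nothing
        cancels.\<close>
      moreover have "(\<Sum>x\<in>R. h x * - sgn (F x0)) > 0"
      proof (rule sum_pos2)
        have pos: "h x * - sgn (F x0) > 0" if "x \<in> R" "x \<in> T" for x
        proof -
          have "h x * - sgn (F x0) = \<bar>F x\<bar>"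
            using hR [OF that(1)] sgnF [OF that] that(2) abs_sgn [of "F x"] by simp
          with sgnF [OF that] show ?thesis by simp
        qed
        show "h x0 * - sgn (F x0) > 0" using pos [of x0] x0(1) by (simp add: R_def)
        show "h x * - sgn (F x0) \<ge> 0" if "x \<in> R" for x
          using pos [OF that] hR [OF that] by (cases "x \<in> T") auto
      qed (auto simp: R_def)
      ultimately show False by simp
    qed
  qed
  then have "characteristic_polynomial \<rho> m =
      monom 1 (m - n) * (\<Prod>i=1..n. [:- int (card (A i)), 1:]) \<longleftrightarrow> T = {}"
    by (simp add: diff [symmetric])
  then show ?thesis by (auto simp: assms(4))
qed

end
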